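(* Consider the randomized gossip algorithm with unreliable communication on $n\ge 3$ nodes with node pair selection matrix $A=[a_{ij}]$ (as defined in the context), and suppose that communication is independent, i.e. the events $\mathbb{E}_k^+$ and $\mathbb{E}_k^-$ are independent for all $k$. Then the condition $\sum_{k=0}^\infty(P_k^++P_k^-)=\infty$ always ensures global a.s. consensus only if both $\mathcal{G}_0$ and its converse graph $\mathcal{G}_0^T$ are quasi-strongly connected. That is: if, for the given $A$, global a.s. consensus is achieved for every choice of sequences $\{P_k^+\}_{k\ge0},\{P_k^-\}_{k\ge0}$ in $[0,1]$ with $\sum_{k=0}^\infty(P_k^++P_k^-)=\infty$, then both $\mathcal{G}_0$ and $\mathcal{G}_0^T$ are quasi-strongly connected.
   Context: Network model. The node set is $\mathcal{V}=\{1,\dots,n\}$, $n\ge3$. $A=[a_{ij}]\in\mathbb{R}^{n\times n}$ is a stochastic matrix (nonnegative entries, each row sums to $1$). The underlying digraph is $\mathcal{G}_0=(\mathcal{V},\mathcal{E}_0)$ with $(j,i)\in\mathcal{E}_0$ if and only if $a_{ij}>0$. Its converse graph $\mathcal{G}_0^T$ is obtained by reversing all arcs. A digraph is quasi-strongly connected if it has a center, i.e. a node from which every other node is reachable by a directed path. Node pair selection process. Independently at each time $k=0,1,2,\dots$, a node $i\in\mathcal{V}$ is drawn with probability $1/n$, and then node $i$ picks the (ordered) pair $(i,j)$ with probability $a_{ij}$. Node communication process. $\{P_k^+\}_{k\ge0}$ and $\{P_k^-\}_{k\ge0}$ are deterministic sequences in $[0,1]$. Independently over time, and independently of the node states and of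 the node pair selection process, $\mathbf{P}(\mathbb{E}_k^+)=P_k^+$ and $\mathbf{P}(\mathbb{E}_k^-)=P_k^-$, where $\mathbb{E}_k^+$ is the event that node $i$ receives $x_j(k)$ when $(i,j)$ is selected at time $k$, and $\mathbb{E}_k^-$ is the event that node $j$ receives $x_i(k)$ when $(i,j)$ is selected at time $k$. Algorithm. Let $k_0\ge0$ be an arbitrary integer initial time and $x(k_0)=x^0\in\mathbb{R}^n$ a deterministic initial condition. For $k\ge k_0$, $x_i(k+1)=\frac12x_i(k)+\frac12x_j(k)$ if $(i,j)$ or $(j,i)$ is selected at time $k$ and $i$ receives $x_j(k)$; otherwise $x_i(k+1)=x_i(k)$. Consensus. Let $\mathcal{H}(k)=\max_i x_i(k)-\min_i x_i(k)$. Global a.s. consensus is achieved if $\mathbf{P}(\lim_{k\to\infty}\mathcal{H}(k)=0)=1$ for any initial condition $x^0\in\mathbb{R}^n$ (with $k_0\ge 0$ arbitrary). *)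

theory Defs
  imports "HOL-Probability.Probability"
begin

definition stochastic_matrix :: "real ^ 'n ^ 'n \<Rightarrow> bool" where
  "stochastic_matrix A \<longleftrightarrow> (\<forall>i j. 0 \<le> A $ i $ j) \<and> (\<forall>i. (\<Sum>j\<in>UNIV. A $ i $ j) = 1)"

text \<open>The arc \<open>(j, i)\<close> points in the direction of the information flow: it is present iff
  \<open>i\<close> picks \<open>j\<close> with positive probability.\<close>

definition underlying_digraph :: "real ^ 'n ^ 'n \<Rightarrow> ('n \<times> 'n) set" where
  "underlying_digraph A = {(j, i). A $ i $ j > 0}"

definition quasi_strongly_connected :: "('n \<times> 'n) set \<Rightarrow> bool" where
  "quasi_strongly_connected E \<longleftrightarrow> (\<exists>c. \<forall>v. (c, v) \<in> E\<^sup>*)"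

definition pair_selection_pmf :: "real ^ 'n ^ 'n \<Rightarrow> ('n \<times> 'n) pmf" where
  "pair_selection_pmf A =
     bind_pmf (pmf_of_set UNIV) (\<lambda>i. map_pmf (Pair i) (embed_pmf (\<lambda>j. A $ i $ j)))"

lemma pmf_pair_selection_pmf:
  fixes A :: "real ^ 'n ^ 'n"
  assumes "stochastic_matrix A"
  shows "pmf (pair_selection_pmf A) (i, j) = A $ i $ j / real CARD('n)"
proof -
  have row: "pmf (embed_pmf (\<lambda>j. A $ i $ j)) j = A $ i $ j" for i j
    using assms
    by (intro pmf_embed_pmf)
       (auto simp: stochastic_matrix_def nn_integral_count_space_finite)
  have "pmf (map_pmf (Pair i') (embed_pmf (\<lambda>j. A $ i' $ j))) (i, j) =
      (if i' = i then A $ i $ j else 0)" for i'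
  proof (cases "i' = i")
    case True
    then show ?thesis
      using pmf_map_inj'[of "Pair i" "embed_pmf (\<lambda>j. A $ i $ j)" j] by (simp add: row inj_def)
  next
    case False
    then show ?thesis by (auto simp: pmf_eq_0_set_pmf)
  qed
  then show ?thesis
    by (simp add: pair_selection_pmf_def pmf_bind integral_pmf_of_set)
qed

text \<open>The randomness of one time step is a triple \<open>((i, j), e\<^sup>+, e\<^sup>-)\<close>: the selected ordered pair,
  whether \<open>i\<close> receives the state of \<open>j\<close>, and whether \<open>j\<close> receives the state of \<open>i\<close>. The three
  components are independent. The Bernoulli laws are meaningful for parameters in \<open>[0, 1]\<close>.\<close>

type_synonym 'n gossip_event = "('n \<times> 'n) \<times> bool \<times> bool"

definition gossip_event_pmf :: "real ^ 'n ^ 'n \<Rightarrow> real \<Rightarrow> real \<Rightarrow> 'n gossip_event pmf" where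
  "gossip_event_pmf A p q =
     pair_pmf (pair_selection_pmf A) (pair_pmf (bernoulli_pmf p) (bernoulli_pmf q))"

text \<open>The canonical probability space of the whole process. The product measure expresses
  independence over time.\<close>

definition gossip_space ::
    "real ^ 'n ^ 'n \<Rightarrow> (nat \<Rightarrow> real) \<Rightarrow> (nat \<Rightarrow> real) \<Rightarrow> (nat \<Rightarrow> 'n gossip_event) measure" where
  "gossip_space A Pp Pm = PiM UNIV (\<lambda>k. measure_pmf (gossip_event_pmf A (Pp k) (Pm k)))"

lemma prob_space_gossip_space: "prob_space (gossip_space A Pp Pm)"
  unfolding gossip_space_def by (intro prob_space_PiM prob_space_measure_pmf)

lemma distr_gossip_space_component:
  "distr (gossip_space A Pp Pm) (measure_pmf (gossip_event_pmf A (Pp k) (Pm k))) (\<lambda>\<omega>. \<omega> k) =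
     measure_pmf (gossip_event_pmf A (Pp k) (Pm k))"
  unfolding gossip_space_def by (intro distr_PiM_component prob_space_measure_pmf) simp

fun gossip_update :: "'n gossip_event \<Rightarrow> real ^ 'n \<Rightarrow> real ^ 'n" where
  "gossip_update ((i, j), ep, em) x =
     (\<chi> v. if v = i \<and> ep then x $ i / 2 + x $ j / 2
           else if v = j \<and> em then x $ j / 2 + x $ i / 2
           else x $ v)"

text \<open>The state at absolute time \<open>k\<close>; for \<open>k \<le> k0\<close> it is the initial condition.\<close>

primrec gossip_state ::
    "nat \<Rightarrow> real ^ 'n \<Rightarrow> (nat \<Rightarrow> 'n gossip_event) \<Rightarrow> nat \<Rightarrow> real ^ 'n" where
  "gossip_state k0 x0 \<omega> 0 = x0"
| "gossip_state k0 x0 \<omega> (Suc k) =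
     (if k < k0 then x0 else gossip_update (\<omega> k) (gossip_state k0 x0 \<omega> k))"

definition disagreement :: "real ^ 'n \<Rightarrow> real" where
  "disagreement x = Max (range (($) x)) - Min (range (($) x))"

definition global_as_consensus ::
    "real ^ 'n ^ 'n \<Rightarrow> (nat \<Rightarrow> real) \<Rightarrow> (nat \<Rightarrow> real) \<Rightarrow> bool" where
  "global_as_consensus A Pp Pm \<longleftrightarrow>
     (\<forall>k0 x0. AE \<omega> in gossip_space A Pp Pm.
        (\<lambda>k. disagreement (gossip_state k0 x0 \<omega> k)) \<longlonglongrightarrow> 0)"

end

theory Submission
  imports Defs
begin

text \<open>Take \<open>P\<^sup>+ = 1\<close>, \<open>P\<^sup>- = 0\<close>: information then flows along arcs of the underlying digraph only.
  If that digraph has no center, some two nodes have no common ancestor, so their ancestor sets are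
  disjoint and receive nothing from outside. Starting with the value 0 on one and 1 on the other,
  both stay constant and the disagreement is always at least 1. Exchanging the roles of
  \<open>P\<^sup>+\<close> and \<open>P\<^sup>-\<close> gives the converse graph.\<close>

text \<open>Finiteness carries the property from pairs to the whole node set: a node reaching all of
  \<open>F\<close> and a new node \<open>u\<close> have a common ancestor, which by transitivity
  reaches all of \<open>insert u F\<close>.\<close>

lemma quasi_strongly_connectedI_common_ancestor:
  fixes E :: "('n::finite \<times> 'n) set"
  assumes "\<And>u v. \<exists>c. (c, u) \<in> E\<^sup>* \<and> (c, v) \<in> E\<^sup>*"
  shows "quasi_strongly_connected E"
proof -
  have "\<exists>c. \<forall>v\<in>F. (c, v) \<in> E\<^sup>*" for F :: "'n set"
  proof (induction F rule: finite_induct[OF finite])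
    case 1
    then show ?case by simp
  next
    case (2 u F)
    then obtain c where c: "\<forall>v\<in>F. (c, v) \<in> E\<^sup>*" by blast
    obtain d where "(d, u) \<in> E\<^sup>*" "(d, c) \<in> E\<^sup>*" using assms by blast
    with c have "\<forall>v\<in>insert u F. (d, v) \<in> E\<^sup>*" by (auto intro: rtrancl_trans)
    then show ?case ..
  qed
  from this[of UNIV] show ?thesis by (simp add: quasi_strongly_connected_def)
qed

text \<open>A node of \<open>S\<close> that receives a value receives it from a node of
  \<open>S\<close>, so it averages two copies of \<open>c\<close>.\<close>

lemma gossip_update_constant_on:
  assumes closed: "\<And>u v. (u, v) \<in> E \<Longrightarrow> v \<in> S \<Longrightarrow> u \<in> S"
    and "ep \<Longrightarrow> (j, i) \<in> E" and "em \<Longrightarrow> (i, j) \<in> E"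
    and "\<And>v. v \<in> S \<Longrightarrow> x $ v = c" and "v \<in> S"
  shows "gossip_update ((i, j), ep, em) x $ v = c"
  using assms by auto

lemma gossip_state_constant_on:
  assumes closed: "\<And>u v. (u, v) \<in> E \<Longrightarrow> v \<in> S \<Longrightarrow> u \<in> S"
    and "\<And>k i j ep em. \<omega> k = ((i, j), ep, em) \<Longrightarrow>
           (ep \<longrightarrow> (j, i) \<in> E) \<and> (em \<longrightarrow> (i, j) \<in> E)"
    and "\<And>v. v \<in> S \<Longrightarrow> x0 $ v = c" and "v \<in> S"
  shows "gossip_state k0 x0 \<omega> k $ v = c"
  using \<open>v \<in> S\<close>
proof (induction k arbitrary: v)
  case 0
  then show ?case using assms(3) by simp
next
  case (Suc k)
  obtain i j ep em where \<omega>: "\<omega> k = ((i, j), ep, em)" by (metis surj_pair)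
  have "gossip_update (\<omega> k) (gossip_state k0 x0 \<omega> k) $ v = c"
    unfolding \<omega>
    by (rule gossip_update_constant_on[where E = E and S = S, OF closed])
      (use assms(2)[OF \<omega>] Suc in auto)
  \<comment> \<open>Up to time \<open>k0\<close> the state is still \<open>x0\<close>, so that
    branch falls back on the initial values.\<close>
  then show ?case using assms(3) Suc.prems by simp
qed

lemma diff_le_disagreement: "x $ u - x $ v \<le> disagreement x"
  unfolding disagreement_def by (intro diff_mono Max_ge Min_le) auto

text \<open>There are only countably many times, so the null sets can be collected. This reduces the
  probabilistic claim to an argument about single paths.\<close>

lemma AE_gossip_space_set_pmf:
  "AE \<omega> in gossip_space A Pp Pm. \<forall>k. \<omega> k \<in> set_pmf (gossip_event_pmf A (Pp k) (Pm k))"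
  unfolding AE_all_countable gossip_space_def
  by (intro allI AE_PiM_component prob_space_measure_pmf) (auto simp: AE_measure_pmf)

text \<open>\<open>E\<close> is any relation containing all transmissions of positive probability,
  directed from sender to receiver. Left abstract, it serves the digraph and its converse
  alike.\<close>

lemma quasi_strongly_connected_if_consensus:
  fixes A :: "real ^ 'n ^ 'n"
  assumes cons: "global_as_consensus A Pp Pm"
    and E: "\<And>k i j ep em. ((i, j), ep, em) \<in> set_pmf (gossip_event_pmf A (Pp k) (Pm k)) \<Longrightarrow>
          (ep \<longrightarrow> (j, i) \<in> E) \<and> (em \<longrightarrow> (i, j) \<in> E)"
  shows "quasi_strongly_connected E"
proof (rule quasi_strongly_connectedI_common_ancestor, rule ccontr)
  fix u v
  assume no_common: "\<nexists>c. (c, u) \<in> E\<^sup>* \<and> (c, v) \<in> E\<^sup>*"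
  \<comment> \<open>The indicator of the ancestors of \<open>u\<close>; it vanishes on the ancestors
    of \<open>v\<close> because a common one is excluded.\<close>
  define x0 :: "real ^ 'n" where "x0 = (\<chi> w. if (w, u) \<in> E\<^sup>* then 1 else 0)"
  have "AE \<omega> in gossip_space A Pp Pm.
      (\<lambda>k. disagreement (gossip_state 0 x0 \<omega> k)) \<longlonglongrightarrow> 0"
    using cons by (simp add: global_as_consensus_def)
  moreover note AE_gossip_space_set_pmf[of A Pp Pm]
  ultimately have "AE \<omega> in gossip_space A Pp Pm. False"
  proof eventually_elim
    case (elim \<omega>)
    have ev: "(ep \<longrightarrow> (j, i) \<in> E) \<and> (em \<longrightarrow> (i, j) \<in> E)"
      if "\<omega> k = ((i, j), ep, em)" for k i j ep em
      using E[of i j ep em k] elim(2) that by metis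
    \<comment> \<open>Ancestor sets are closed under predecessors, by prepending an arc to a
      path.\<close>
    have "gossip_state 0 x0 \<omega> k $ u = 1" for k
      by (rule gossip_state_constant_on[where E = E and S = "{w. (w, u) \<in> E\<^sup>*}", OF _ ev])
        (auto simp: x0_def intro: converse_rtrancl_into_rtrancl)
    moreover have "gossip_state 0 x0 \<omega> k $ v = 0" for k
      by (rule gossip_state_constant_on[where E = E and S = "{w. (w, v) \<in> E\<^sup>*}", OF _ ev])
        (use no_common in \<open>auto simp: x0_def intro: converse_rtrancl_into_rtrancl\<close>)
    ultimately have "1 \<le> disagreement (gossip_state 0 x0 \<omega> k)" for k
      using diff_le_disagreement[of "gossip_state 0 x0 \<omega> k" u v] by simp
    then have "(1::real) \<le> 0"
      by (intro LIMSEQ_le_const[OF elim(1)]) auto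
    then show False by simp
  qed
  then show False
    using prob_space.AE_False[OF prob_space_gossip_space] by blast
qed

lemma set_pmf_bernoulli_0: "set_pmf (bernoulli_pmf 0) = {False}"
  and set_pmf_bernoulli_1: "set_pmf (bernoulli_pmf 1) = {True}"
proof -
  have "b \<in> set_pmf (bernoulli_pmf 0) \<longleftrightarrow> \<not> b" "b \<in> set_pmf (bernoulli_pmf 1) \<longleftrightarrow> b" for b
    by (cases b; simp add: set_pmf_iff)+
  then show "set_pmf (bernoulli_pmf 0) = {False}" "set_pmf (bernoulli_pmf 1) = {True}"
    by auto
qed

lemma set_pmf_pair_selection_pmf:
  fixes A :: "real ^ 'n ^ 'n"
  assumes "stochastic_matrix A"
  shows "set_pmf (pair_selection_pmf A) = {(i, j). A $ i $ j > 0}"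
proof -
  have "A $ i $ j \<ge> 0" for i j using assms by (simp add: stochastic_matrix_def)
  then show ?thesis
    by (auto simp: set_pmf_iff pmf_pair_selection_pmf[OF assms] less_le)
qed

theorem proposition1:
  fixes A :: "real ^ 'n ^ 'n"
  assumes "CARD('n) \<ge> 3"
    and "stochastic_matrix A"
    and "\<And>Pp Pm :: nat \<Rightarrow> real.
           (\<forall>k. Pp k \<in> {0..1}) \<Longrightarrow> (\<forall>k. Pm k \<in> {0..1}) \<Longrightarrow>
           \<not> summable (\<lambda>k. Pp k + Pm k) \<Longrightarrow> global_as_consensus A Pp Pm"
  shows "quasi_strongly_connected (underlying_digraph A) \<and>
         quasi_strongly_connected ((underlying_digraph A)\<inverse>)"
proof
  have not_summable: "\<not> summable (\<lambda>k::nat. 1::real)" by (simp add: summable_const_iff)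
  note supp = gossip_event_pmf_def set_pmf_pair_selection_pmf[OF assms(2)]
    set_pmf_bernoulli_0 set_pmf_bernoulli_1 underlying_digraph_def
  \<comment> \<open>Only the picking node \<open>i\<close> ever receives, along the arc
    \<open>(j, i)\<close>.\<close>
  have "global_as_consensus A (\<lambda>k. 1) (\<lambda>k. 0)"
    by (rule assms(3)) (simp_all add: not_summable)
  then show "quasi_strongly_connected (underlying_digraph A)"
    by (rule quasi_strongly_connected_if_consensus) (auto simp: supp)
  \<comment> \<open>Now only the picked node \<open>j\<close> receives, along the reversed arc
    \<open>(i, j)\<close>.\<close>
  have "global_as_consensus A (\<lambda>k. 0) (\<lambda>k. 1)"
    by (rule assms(3)) (simp_all add: not_summable)
  then show "quasi_strongly_connected ((underlying_digraph A)\<inverse>)"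
    by (rule quasi_strongly_connected_if_consensus) (auto simp: supp)
qed

end
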